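(* Let $R$ be a finite commutative ring with unity with $R\cong R_1\times R_2\times\cdots\times R_n$, where $n\ge 2$ and each $R_i$ is a local ring. Then $G_{\mathrm{Id}}(R)$ is a cograph if and only if one of the following holds: (i) $\mathrm{char}(R_i)=2$ for each $i$; (ii) $R\cong \mathbb{Z}_3\times R_2\times R_3\times\cdots\times R_n$ with $\mathrm{char}(R_i)=2$ for $2\le i\le n$.
   Context: For a ring $S$ with unity, an element $x\in S$ is idempotent if $x^2=x$; $\mathrm{Id}(S)$ denotes the set of idempotents of $S$. The idempotent graph $G_{\mathrm{Id}}(S)$ is the simple undirected graph with vertex set $S$ in which two distinct vertices $x,y$ are adjacent if and only if $x+y\in \mathrm{Id}(S)$. A ring is local if it has a unique maximal ideal. $\mathrm{char}(S)$ is the least positive integer $m$ with $m\cdot 1=0$. A cograph is a graph with no induced subgraph isomorphic to the path $P_4$ on four vertices.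
   Formalization: Case (ii) is stated up to renumbering: for some k, R is isomorphic to Z_3 times the product of the R_i with i ≠ k, each of characteristic 2; with the numbering fixed the "only if" fails for R_1 = Z_2, R_2 = Z_3. *)

theory Defs
  imports
    "HOL-Algebra.Chinese_Remainder"
    "HOL-Algebra.IntRing"
    "Graph_Theory.Pair_Digraph"
    "Graph_Theory.Digraph_Component"
    "Graph_Theory.Digraph_Isomorphism"
begin

section \<open>Rings\<close>

definition idempotents :: "('a, 'm) ring_scheme \<Rightarrow> 'a set" where
  "idempotents S = {x \<in> carrier S. x \<otimes>\<^bsub>S\<^esub> x = x}"

text \<open>The zero ring has no maximal ideal, so it is not local.\<close>

locale local_ring = cring +
  assumes unique_maximalideal: "\<exists>!M. maximalideal M R"

text \<open>
  Only meaningful when some positive multiple of the unit vanishes (e.g. for finite rings);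
  the convention that the characteristic is 0 otherwise is not built in.
\<close>

definition ring_char :: "('a, 'm) ring_scheme \<Rightarrow> nat" where
  "ring_char S = (LEAST m. 0 < m \<and> [m] \<cdot>\<^bsub>S\<^esub> \<one>\<^bsub>S\<^esub> = \<zero>\<^bsub>S\<^esub>)"


section \<open>Graphs\<close>

text \<open>
  A simple undirected graph is a loop-free symmetric digraph without parallel arcs: each edge
  is represented by its two orientations.
\<close>

definition idempotent_graph :: "('a, 'm) ring_scheme \<Rightarrow> 'a pair_pre_digraph" where
  "idempotent_graph S =
     \<lparr> pverts = carrier S,
       parcs = {(x, y). x \<in> carrier S \<and> y \<in> carrier S \<and> x \<noteq> y
                        \<and> x \<oplus>\<^bsub>S\<^esub> y \<in> idempotents S} \<rparr>"

lemma pair_graph_idempotent_graph: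
  assumes "cring S" and "finite (carrier S)"
  shows "pair_graph (idempotent_graph S)"
proof -
  interpret cring S by fact
  have "parcs (idempotent_graph S) \<subseteq> carrier S \<times> carrier S"
    by (auto simp: idempotent_graph_def)
  then have "finite (parcs (idempotent_graph S))"
    using assms(2) by (meson finite_SigmaI finite_subset)
  then show ?thesis
    using assms(2)
    by unfold_locales
      (auto simp: idempotent_graph_def symmetric_def a_comm intro!: symI)
qed

definition path_graph :: "nat \<Rightarrow> nat pair_pre_digraph" where
  "path_graph k =
     \<lparr> pverts = {..<k},
       parcs = {(i, j). i < k \<and> j < k \<and> (j = Suc i \<or> i = Suc j)} \<rparr>"

lemma pair_graph_path_graph: "pair_graph (path_graph k)"
proof -
  have "parcs (path_graph k) \<subseteq> {..<k} \<times> {..<k}"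
    by (auto simp: path_graph_def)
  then have "finite (parcs (path_graph k))"
    by (meson finite_SigmaI finite_subset finite_lessThan)
  then show ?thesis
    by unfold_locales (auto simp: path_graph_def symmetric_def intro!: symI)
qed

definition cograph :: "('a, 'b) pre_digraph \<Rightarrow> bool" where
  "cograph G \<longleftrightarrow>
     graph G \<and> \<not> (\<exists>H. induced_subgraph H G \<and> digraph_iso H (with_proj (path_graph 4)))"

end

theory Submission
  imports Defs "HOL-Algebra.Multiplicative_Group" "HOL-Decision_Procs.Algebra_Aux"
begin

text \<open>
  Both cases of the theorem say that \<open>6 = 0\<close> in \<open>R\<close> and that \<open>2 x\<close> is \<open>0\<close>, \<open>2\<close> or \<open>-2\<close> for every \<open>x\<close>.
  Under this condition, adjacency is decided separately by the multiples \<open>3 x\<close> and \<open>2 x\<close>: a path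
  makes the \<open>3\<close>-part of every sum of two of its vertices idempotent, so its non-edges
  \<open>a c\<close>, \<open>a d\<close>, \<open>b d\<close> all have \<open>2 (x + y) = -2\<close>; then \<open>2 (b + c) = -2\<close> too, contradicting
  the edge \<open>b c\<close>.

  Conversely \<open>0, 1, -1, 2\<close> is an induced path unless \<open>6 = 0\<close>, and \<open>x, -x, 1 + x, -1 - x\<close> is one
  unless \<open>2 = 0\<close> or \<open>b = 1 + 2 x\<close> satisfies \<open>b\<^sup>2 = b\<close> or \<open>b\<^sup>2 = -b\<close>. As local rings have only trivial
  idempotents, \<open>6 = 0\<close> forces \<open>2 = 0\<close> or \<open>3 = 0\<close> in each factor. In the factors with \<open>3 = 0\<close> the
  components of \<open>b\<close> can be prescribed, so such a factor has only the elements \<open>0, 1, -1\<close>, and two such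
  factors are excluded by a \<open>b\<close> with components \<open>1\<close> and \<open>-1\<close>.
\<close>

section \<open>Induced paths on four vertices\<close>

text \<open>The vertex part of the isomorphism is inverted to list the vertices in path order. Since
  \<open>H\<close> is induced, adjacency in \<open>G\<close> between listed vertices is adjacency in
  \<open>H\<close>, which the arc part of the isomorphism carries to the path.\<close>

lemma induced_path4_vertices:
  assumes "induced_subgraph H (with_proj G)" and "digraph_iso H (with_proj (path_graph 4))"
  shows "\<exists>v. inj_on v {..<4} \<and> v ` {..<4} \<subseteq> pverts G
    \<and> (\<forall>i<4. \<forall>j<4. (v i, v j) \<in> parcs G \<longleftrightarrow> j = Suc i \<or> i = Suc j)"
proof -
  have sub: "verts H \<subseteq> pverts G"
    and arcs: "arcs H = {e \<in> parcs G. fst e \<in> verts H \<and> snd e \<in> verts H}"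
    and ends: "tail H = fst" "head H = snd"
    using assms(1) by (auto simp: induced_subgraph_def subgraph_def compatible_def)
  obtain f where f: "pre_digraph.digraph_isomorphism H f"
    and app: "with_proj (path_graph 4) = app_iso f H"
    using assms(2) by (auto simp: digraph_iso_def)
  have iv: "iso_verts f ` verts H = {..<4}"
    using arg_cong[OF app, of verts] by (simp add: path_graph_def)
  have ia: "iso_arcs f ` arcs H = parcs (path_graph 4)"
    using arg_cong[OF app, of arcs] by simp
  have it: "iso_tail f = fst" "iso_head f = snd"
    using arg_cong[OF app, of tail] arg_cong[OF app, of head] by simp_all
  have inj: "inj_on (iso_verts f) (verts H)"
    using f by (simp add: pre_digraph.digraph_isomorphism_def)
  have arc: "iso_arcs f e = (iso_verts f (fst e), iso_verts f (snd e))" if "e \<in> arcs H" for e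
    using f that by (auto simp: pre_digraph.digraph_isomorphism_def it ends prod_eq_iff)
  define v where "v = inv_into (verts H) (iso_verts f)"
  have vH: "v i \<in> verts H" and fv: "iso_verts f (v i) = i" if "i < 4" for i
    using that iv by (auto simp: v_def inv_into_into f_inv_into_f)
  have vf: "v (iso_verts f x) = x" if "x \<in> verts H" for x
    using that inj by (simp add: v_def)
  have adj: "(v i, v j) \<in> parcs G \<longleftrightarrow> (i, j) \<in> parcs (path_graph 4)" if ij: "i < 4" "j < 4" for i j
  proof
    assume "(v i, v j) \<in> parcs G"
    then have "(v i, v j) \<in> arcs H"
      using arcs vH ij by simp
    then show "(i, j) \<in> parcs (path_graph 4)"
      using arc[of "(v i, v j)"] ia fv ij by (metis fst_conv image_eqI snd_conv)
  next
    assume "(i, j) \<in> parcs (path_graph 4)"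
    then obtain e where e: "e \<in> arcs H" "iso_arcs f e = (i, j)"
      using ia by (metis imageE)
    \<comment> \<open>Arcs of \<open>H\<close> are pairs of vertices, so an arc is recovered from
      the images of its two ends.\<close>
    then have "e = (v i, v j)"
      using arc[OF e(1)] arcs vf e(1) by (auto simp: prod_eq_iff)
    then show "(v i, v j) \<in> parcs G"
      using e arcs by auto
  qed
  show ?thesis
  proof (intro exI[of _ v] conjI allI impI)
    show "inj_on v {..<4}"
      using fv by (metis inj_onI lessThan_iff)
    show "v ` {..<4} \<subseteq> pverts G"
      using vH sub by auto
    show "(v i, v j) \<in> parcs G \<longleftrightarrow> j = Suc i \<or> i = Suc j" if "i < 4" "j < 4" for i j
      using adj[OF that] that by (auto simp: path_graph_def)
  qed
qed

lemma path4_arcs: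
  "parcs (path_graph 4) = {(0, 1), (1, 0), (1, 2), (2, 1), (2, 3), (3, 2)}"
  by (auto simp: path_graph_def)

text \<open>Replaces the isomorphism in the definition of a cograph by a condition on four vertices.
  Six pairs suffice because the arcs are symmetric and there are no loops.\<close>

lemma cograph_with_proj_iff:
  assumes "pair_graph G"
  shows "cograph (with_proj G) \<longleftrightarrow>
    \<not> (\<exists>a b c d. {a, b, c, d} \<subseteq> pverts G \<and> distinct [a, b, c, d]
          \<and> (a, b) \<in> parcs G \<and> (b, c) \<in> parcs G \<and> (c, d) \<in> parcs G
          \<and> (a, c) \<notin> parcs G \<and> (a, d) \<notin> parcs G \<and> (b, d) \<notin> parcs G)"
    (is "_ \<longleftrightarrow> \<not> ?P")
proof -
  interpret G: pair_graph G by fact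
  have graph: "graph (with_proj G)"
    using G.sym_arcs by unfold_locales
  have sym: "(x, y) \<in> parcs G \<longleftrightarrow> (y, x) \<in> parcs G" for x y
    using G.pair_sym_arcs by (auto simp: symmetric_def dest: symD)
  have irr: "(x, x) \<notin> parcs G" for x
    using G.pair_no_loops by force
  have "?P" if iso: "induced_subgraph H (with_proj G)" "digraph_iso H (with_proj (path_graph 4))" for H
  proof -
    obtain v where v: "inj_on v {..<4}" "v ` {..<4} \<subseteq> pverts G"
      "\<forall>i<4. \<forall>j<4. (v i, v j) \<in> parcs G \<longleftrightarrow> j = Suc i \<or> i = Suc j"
      using induced_path4_vertices[OF iso] by blast
    have "distinct [v 0, v 1, v 2, v 3]"
      by (simp add: inj_on_eq_iff[OF v(1)])
    moreover have "{v 0, v 1, v 2, v 3} \<subseteq> pverts G"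
      using v(2) by (simp add: image_subset_iff)
    moreover have "(v 0, v 1) \<in> parcs G" "(v 1, v 2) \<in> parcs G" "(v 2, v 3) \<in> parcs G"
      "(v 0, v 2) \<notin> parcs G" "(v 0, v 3) \<notin> parcs G" "(v 1, v 3) \<notin> parcs G"
      using v(3) by simp_all
    ultimately show ?P by blast
  qed
  moreover have "\<exists>H. induced_subgraph H (with_proj G) \<and> digraph_iso H (with_proj (path_graph 4))"
    if ?P
  proof -
    from that obtain a b c d where abcd: "{a, b, c, d} \<subseteq> pverts G" "distinct [a, b, c, d]"
      "(a, b) \<in> parcs G" "(b, c) \<in> parcs G" "(c, d) \<in> parcs G"
      "(a, c) \<notin> parcs G" "(a, d) \<notin> parcs G" "(b, d) \<notin> parcs G" by blast
    define H where "H = with_proj G \<restriction> {a, b, c, d}"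
    have ind: "induced_subgraph H (with_proj G)"
      unfolding H_def using abcd(1) by (intro G.induced_induce) simp
    have reversed: "(b, a) \<in> parcs G" "(c, b) \<in> parcs G" "(d, c) \<in> parcs G"
      "(c, a) \<notin> parcs G" "(d, a) \<notin> parcs G" "(d, b) \<notin> parcs G"
      using abcd(3-) sym by blast+
    have arcs_H: "arcs H = {(a, b), (b, a), (b, c), (c, b), (c, d), (d, c)}"
    proof (intro equalityI subrelI)
      fix x y assume "(x, y) \<in> arcs H"
      then have "x \<in> {a, b, c, d}" "y \<in> {a, b, c, d}" "(x, y) \<in> parcs G"
        by (simp_all add: H_def)
      then show "(x, y) \<in> {(a, b), (b, a), (b, c), (c, b), (c, d), (d, c)}"
        by (elim insertE emptyE; simp add: abcd(3-) reversed irr)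
    next
      fix x y assume "(x, y) \<in> {(a, b), (b, a), (b, c), (c, b), (c, d), (d, c)}"
      then show "(x, y) \<in> arcs H"
        by (elim insertE emptyE; simp add: abcd(3-) reversed H_def)
    qed
    \<comment> \<open>Position along the path; the last default value 3 is the position of
      \<open>d\<close>. The isomorphism \<open>h\<close> acts on arcs by applying \<open>f\<close>
      to both ends.\<close>
    define f :: "'a \<Rightarrow> nat" where "f = (\<lambda>x. if x = a then 0 else if x = b then 1 else if x = c then 2 else 3)"
    define h where "h = \<lparr>iso_verts = f, iso_arcs = map_prod f f, iso_head = snd, iso_tail = fst\<rparr>"
    have inj: "inj_on f {a, b, c, d}"
      using abcd(2) by (auto simp: f_def inj_on_def)
    have "wf_digraph H"
      using ind by (auto simp: induced_subgraph_def subgraph_def)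
    moreover have "inj_on (map_prod f f) (arcs H)"
      by (rule inj_on_subset[OF map_prod_inj_on[OF inj inj]]) (auto simp: arcs_H)
    ultimately have "pre_digraph.digraph_isomorphism H h"
      using inj by (auto simp: pre_digraph.digraph_isomorphism_def h_def H_def)
    moreover have "with_proj (path_graph 4) = app_iso h H"
    proof -
      have f: "f a = 0" "f b = 1" "f c = 2" "f d = 3"
        using abcd(2) by (auto simp: f_def)
      have "{..<4} = {0, 1, 2, 3 :: nat}"
        by auto
      then have "f ` {a, b, c, d} = pverts (path_graph 4)"
        by (simp add: f path_graph_def)
      moreover have "map_prod f f ` arcs H = parcs (path_graph 4)"
        by (simp add: f arcs_H path4_arcs)
      ultimately show ?thesis
        by (simp add: app_iso_def with_proj_def h_def H_def)
    qed
    ultimately show ?thesis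
      using ind by (auto simp: digraph_iso_def)
  qed
  ultimately show ?thesis
    using graph unfolding cograph_def by blast
qed

section \<open>Induced paths in the idempotent graph\<close>

context cring
begin

lemma idempotents_iff: "x \<in> idempotents R \<longleftrightarrow> x \<in> carrier R \<and> x \<otimes> x = x"
  by (auto simp: idempotents_def)

text \<open>Written as sums of ones, the numerals become terms with which \<open>algebra\<close> can
  compute.\<close>

lemma of_int_numerals:
  "\<guillemotleft>2\<guillemotright> = \<one> \<oplus> \<one>"
  "\<guillemotleft>3\<guillemotright> = \<one> \<oplus> (\<one> \<oplus> \<one>)"
  "\<guillemotleft>6\<guillemotright> = \<one> \<oplus> (\<one> \<oplus> (\<one> \<oplus> (\<one> \<oplus> (\<one> \<oplus> \<one>))))"
  using of_int_add[of 1 1] of_int_add[of 1 2] of_int_add[of 3 3]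
  by (simp_all add: a_assoc)

text \<open>Serves to refute \<open>x = y\<close>: it is enough to exhibit a nonzero
  \<open>u\<close> as a multiple of the difference.\<close>

lemma eq_zero_if_multiple_of_diff:
  assumes "x = y" and "u = c \<otimes> (x \<ominus> y)" and "c \<in> carrier R" and "x \<in> carrier R"
  shows "u = \<zero>"
  using assms by (simp add: minus_eq r_neg)

text \<open>As the vertices are distinct, being adjacent in the idempotent graph amounts to having
  an idempotent sum.\<close>

definition induced_path :: "'a \<Rightarrow> 'a \<Rightarrow> 'a \<Rightarrow> 'a \<Rightarrow> bool" where
  "induced_path a b c d \<longleftrightarrow> {a, b, c, d} \<subseteq> carrier R \<and> distinct [a, b, c, d]
     \<and> a \<oplus> b \<in> idempotents R \<and> b \<oplus> c \<in> idempotents R \<and> c \<oplus> d \<in> idempotents R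
     \<and> a \<oplus> c \<notin> idempotents R \<and> a \<oplus> d \<notin> idempotents R \<and> b \<oplus> d \<notin> idempotents R"

text \<open>Consecutive sums are 1, 0, 1. Every equation that would spoil the path, be it between
  two vertices or saying that one of the sums -1, 2, 3 is idempotent, has a difference of sides that
  divides 6; the constant \<open>c\<close> is the cofactor.\<close>

lemma induced_path_0_1_neg1_2:
  assumes "\<guillemotleft>6\<guillemotright> \<noteq> \<zero>"
  shows "induced_path \<zero> \<one> (\<ominus> \<one>) \<guillemotleft>2\<guillemotright>"
proof -
  have z: False if "x = y" "\<guillemotleft>6\<guillemotright> = c \<otimes> (x \<ominus> y)" "c \<in> carrier R" "x \<in> carrier R" for x y c
    using eq_zero_if_multiple_of_diff[OF that] assms by simp
  have "\<zero> \<noteq> \<one>"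
    by (rule notI, erule z[where c = "\<guillemotleft>-6\<guillemotright>"]) (simp only: of_int_numerals of_int_minus, algebra, simp_all)
  moreover have "\<zero> \<noteq> \<ominus> \<one>"
    by (rule notI, erule z[where c = "\<guillemotleft>6\<guillemotright>"]) (simp only: of_int_numerals of_int_minus, algebra, simp_all)
  moreover have "\<zero> \<noteq> \<guillemotleft>2\<guillemotright>"
    by (rule notI, erule z[where c = "\<guillemotleft>-3\<guillemotright>"]) (simp only: of_int_numerals of_int_minus, algebra, simp_all)
  moreover have "\<one> \<noteq> \<ominus> \<one>"
    by (rule notI, erule z[where c = "\<guillemotleft>3\<guillemotright>"]) (simp only: of_int_numerals of_int_minus, algebra, simp_all)
  moreover have "\<one> \<noteq> \<guillemotleft>2\<guillemotright>"
    by (rule notI, erule z[where c = "\<guillemotleft>-6\<guillemotright>"]) (simp only: of_int_numerals of_int_minus, algebra, simp_all)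
  moreover have "\<ominus> \<one> \<noteq> \<guillemotleft>2\<guillemotright>"
    by (rule notI, erule z[where c = "\<guillemotleft>-2\<guillemotright>"]) (simp only: of_int_numerals of_int_minus, algebra, simp_all)
  moreover have "(\<zero> \<oplus> \<ominus> \<one>) \<otimes> (\<zero> \<oplus> \<ominus> \<one>) \<noteq> \<zero> \<oplus> \<ominus> \<one>"
    by (rule notI, erule z[where c = "\<guillemotleft>3\<guillemotright>"]) (simp only: of_int_numerals of_int_minus, algebra, simp_all)
  moreover have "(\<zero> \<oplus> \<guillemotleft>2\<guillemotright>) \<otimes> (\<zero> \<oplus> \<guillemotleft>2\<guillemotright>) \<noteq> \<zero> \<oplus> \<guillemotleft>2\<guillemotright>"
    by (rule notI, erule z[where c = "\<guillemotleft>3\<guillemotright>"]) (simp only: of_int_numerals of_int_minus, algebra, simp_all)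
  moreover have "(\<one> \<oplus> \<guillemotleft>2\<guillemotright>) \<otimes> (\<one> \<oplus> \<guillemotleft>2\<guillemotright>) \<noteq> \<one> \<oplus> \<guillemotleft>2\<guillemotright>"
    by (rule notI, erule z[where c = "\<one>"]) (simp only: of_int_numerals of_int_minus, algebra, simp_all)
  moreover have "\<ominus> \<one> \<oplus> \<guillemotleft>2\<guillemotright> = \<one>"
    by (simp only: of_int_numerals, algebra)
  moreover have "\<one> \<oplus> \<ominus> \<one> = \<zero>"
    by algebra
  ultimately show ?thesis
    by (simp add: induced_path_def idempotents_iff)
qed

text \<open>Consecutive sums are 0, 1, 0, and the remaining sums are \<open>b\<close>, -1 and
  \<open>-b\<close>. The conditions on \<open>b\<close> say exactly that neither \<open>b\<close>
  nor \<open>-b\<close> is idempotent, and -1 is not idempotent because 2 is nonzero.\<close>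

lemma induced_path_a_neg_a:
  assumes a: "a \<in> carrier R" and 2: "\<guillemotleft>2\<guillemotright> \<noteq> \<zero>"
    and b: "b = \<one> \<oplus> \<guillemotleft>2\<guillemotright> \<otimes> a" "b \<otimes> b \<noteq> b" "b \<otimes> b \<noteq> \<ominus> b"
  shows "induced_path a (\<ominus> a) (\<one> \<oplus> a) (\<ominus> (\<one> \<oplus> a))"
proof -
  have bc: "b \<in> carrier R"
    using a b(1) by simp
  have b_eq: "b = \<one> \<oplus> (\<one> \<oplus> \<one>) \<otimes> a"
    using b(1) by (simp only: of_int_numerals)
  \<comment> \<open>Distinctness is read off from the differences, which up to sign are
    \<open>2 a\<close>, 1, \<open>b\<close> and \<open>b + 1\<close>. They are nonzero, for
    \<open>b\<close> equal to 1 or 0 would be idempotent and \<open>b = -1\<close> would satisfy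
    \<open>b^2 = -b\<close>.\<close>
  have ne: "x \<noteq> y" if "x \<ominus> y = w" "w \<noteq> \<zero>" "x \<in> carrier R" for x y w
    using that by (auto simp: minus_eq r_neg)
  have 1: "\<one> \<noteq> \<zero>" "\<ominus> \<one> \<noteq> \<zero>"
    using 2 by (auto simp: of_int_2)
  have double: "(\<one> \<oplus> \<one>) \<otimes> a \<noteq> \<zero>"
    using b_eq b(2) by auto
  have b0: "b \<noteq> \<zero>" "\<ominus> b \<noteq> \<zero>"
    using b(2) bc by auto
  have "b \<noteq> \<ominus> \<one>"
    using b(3) by (auto simp: l_minus)
  then have b1: "b \<oplus> \<one> \<noteq> \<zero>"
    using bc by (simp add: eq_neg_iff_add_eq_0)
  have "a \<ominus> \<ominus> a = (\<one> \<oplus> \<one>) \<otimes> a"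
    using a by algebra
  then have "a \<noteq> \<ominus> a"
    using ne double a by blast
  moreover have "a \<ominus> (\<one> \<oplus> a) = \<ominus> \<one>"
    using a by algebra
  then have "a \<noteq> \<one> \<oplus> a"
    using ne 1 a by blast
  moreover have "a \<ominus> \<ominus> (\<one> \<oplus> a) = b"
    unfolding b_eq using a by algebra
  then have "a \<noteq> \<ominus> (\<one> \<oplus> a)"
    using ne b0 a by blast
  moreover have "\<ominus> a \<ominus> (\<one> \<oplus> a) = \<ominus> b"
    unfolding b_eq using a by algebra
  then have "\<ominus> a \<noteq> \<one> \<oplus> a"
    using ne b0 a_inv_closed[OF a] by blast
  moreover have "\<ominus> a \<ominus> \<ominus> (\<one> \<oplus> a) = \<one>"
    using a by algebra
  then have "\<ominus> a \<noteq> \<ominus> (\<one> \<oplus> a)"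
    using ne 1 a_inv_closed[OF a] by blast
  moreover have "(\<one> \<oplus> a) \<ominus> \<ominus> (\<one> \<oplus> a) = b \<oplus> \<one>"
    unfolding b_eq using a by algebra
  then have "\<one> \<oplus> a \<noteq> \<ominus> (\<one> \<oplus> a)"
    using ne b1 a_closed[OF one_closed a] by blast
  moreover have "a \<oplus> \<ominus> (\<one> \<oplus> a) = \<ominus> \<one>"
    using a by algebra
  moreover have "\<ominus> \<one> \<otimes> \<ominus> \<one> \<noteq> \<ominus> \<one>"
    using 2 by (simp add: l_minus of_int_2 eq_neg_iff_add_eq_0)
  moreover have "a \<oplus> \<ominus> a = \<zero>"
    using a by algebra
  moreover have "\<ominus> a \<oplus> (\<one> \<oplus> a) = \<one>"
    using a by algebra
  moreover have "(\<one> \<oplus> a) \<oplus> \<ominus> (\<one> \<oplus> a) = \<zero>"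
    using a by algebra
  moreover have "a \<oplus> (\<one> \<oplus> a) = b"
    unfolding b_eq using a by algebra
  moreover have "\<ominus> a \<oplus> \<ominus> (\<one> \<oplus> a) = \<ominus> b"
    unfolding b_eq using a by algebra
  moreover have "\<ominus> b \<otimes> \<ominus> b \<noteq> \<ominus> b"
    using b(3) bc by (simp add: l_minus r_minus)
  ultimately show ?thesis
    using a b(2) bc by (simp add: induced_path_def idempotents_iff)
qed

lemma no_induced_path:
  assumes 6: "\<guillemotleft>6\<guillemotright> = \<zero>"
    and double: "\<And>x. x \<in> carrier R \<Longrightarrow> \<guillemotleft>2\<guillemotright> \<otimes> x \<in> {\<zero>, \<guillemotleft>2\<guillemotright>, \<ominus> \<guillemotleft>2\<guillemotright>}"
  shows "\<not> induced_path a b c d"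
proof
  assume path: "induced_path a b c d"
  then have carr: "a \<in> carrier R" "b \<in> carrier R" "c \<in> carrier R" "d \<in> carrier R"
    by (auto simp: induced_path_def)
  \<comment> \<open>Three times the defect from idempotency. It is additive, because the cross term
    \<open>2 x y\<close> is multiplied by 3 and \<open>6 = 0\<close>.\<close>
  define N where "N = (\<lambda>x. \<guillemotleft>3\<guillemotright> \<otimes> (x \<otimes> x \<ominus> x))"
  have N_idem: "N x = \<zero>" if "x \<in> idempotents R" for x
    using that by (simp add: N_def idempotents_iff minus_eq r_neg)
  have 33: "\<guillemotleft>3\<guillemotright> \<oplus> \<guillemotleft>3\<guillemotright> = \<zero>"
    using 6 of_int_add[of 3 3] by simp
  have N_add: "N (x \<oplus> y) = N x \<oplus> N y" if "x \<in> carrier R" "y \<in> carrier R" for x y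
  proof -
    have "(x \<oplus> y) \<otimes> (x \<oplus> y) \<ominus> (x \<oplus> y)
        = (x \<otimes> x \<ominus> x) \<oplus> (y \<otimes> y \<ominus> y) \<oplus> (x \<otimes> y \<oplus> x \<otimes> y)"
      using that by algebra
    moreover have "t \<otimes> (u \<oplus> v \<oplus> (w \<oplus> w)) = t \<otimes> u \<oplus> t \<otimes> v \<oplus> (t \<oplus> t) \<otimes> w"
      if "t \<in> carrier R" "u \<in> carrier R" "v \<in> carrier R" "w \<in> carrier R" for t u v w
      using that by algebra
    ultimately show ?thesis
      using that 33 by (simp add: N_def)
  qed
  \<comment> \<open>By additivity \<open>N (x + z) + N (y + y) = N (x + y) + N (y + z)\<close>, and
    \<open>N (y + y) = 2 (N y)\<close> vanishes since \<open>6 = 0\<close>. So vanishing passes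
    along the edges of the path.\<close>
  have N_linked: "N (x \<oplus> z) = \<zero>" if "N (x \<oplus> y) = \<zero>" "N (y \<oplus> z) = \<zero>"
    "x \<in> carrier R" "y \<in> carrier R" "z \<in> carrier R" for x y z
  proof -
    have "N (y \<oplus> y) = (\<guillemotleft>3\<guillemotright> \<oplus> \<guillemotleft>3\<guillemotright>) \<otimes> (y \<otimes> y \<ominus> y)"
      using N_add that(4) by (simp add: N_def l_distr)
    then have yy: "N (y \<oplus> y) = \<zero>"
      using 33 that(4) by simp
    have NC: "N u \<in> carrier R" if "u \<in> carrier R" for u
      using that by (simp add: N_def)
    have "N (x \<oplus> z) \<oplus> N (y \<oplus> y) = N (x \<oplus> y) \<oplus> N (y \<oplus> z)"
      using that(3-5) NC by (simp add: N_add a_ac)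
    then show ?thesis
      using that yy NC by simp
  qed
  \<comment> \<open>From \<open>1 = 3 - 2\<close>, the defect \<open>x^2 - x\<close> equals
    \<open>N x - 2 x (x - 1)\<close>. If \<open>N x = 0\<close>, then either of
    \<open>2 x = 0\<close> and \<open>2 x = 2\<close> makes \<open>x\<close> idempotent, and only
    the value -2 is left.\<close>
  have nonidem: "\<guillemotleft>2\<guillemotright> \<otimes> x = \<ominus> \<guillemotleft>2\<guillemotright>" "\<guillemotleft>2\<guillemotright> \<noteq> \<zero>"
    if "x \<notin> idempotents R" "N x = \<zero>" "x \<in> carrier R" for x
  proof -
    have N_eq: "N x = (\<guillemotleft>2\<guillemotright> \<oplus> \<one>) \<otimes> (x \<otimes> x \<ominus> x)"
      using of_int_add[of 2 1] by (simp add: N_def)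
    have "x \<otimes> x \<ominus> x = N x \<ominus> (\<guillemotleft>2\<guillemotright> \<otimes> x) \<otimes> (x \<ominus> \<one>)"
      unfolding N_eq using that(3) of_int_closed[of 2] by algebra
    then have nz: "\<guillemotleft>2\<guillemotright> \<otimes> x \<noteq> \<zero>"
      using that by (auto simp: idempotents_iff eq_diff0)
    have *: "x \<otimes> x \<ominus> x = N x \<ominus> x \<otimes> (\<guillemotleft>2\<guillemotright> \<otimes> x \<ominus> \<guillemotleft>2\<guillemotright>)"
      unfolding N_eq using that(3) of_int_closed[of 2] by algebra
    have "\<guillemotleft>2\<guillemotright> \<otimes> x \<noteq> \<guillemotleft>2\<guillemotright>"
    proof
      assume "\<guillemotleft>2\<guillemotright> \<otimes> x = \<guillemotleft>2\<guillemotright>"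
      with * have "x \<otimes> x \<ominus> x = \<zero>"
        using that by (simp add: minus_eq r_neg)
      then show False
        using that by (auto simp: idempotents_iff eq_diff0)
    qed
    then show "\<guillemotleft>2\<guillemotright> \<otimes> x = \<ominus> \<guillemotleft>2\<guillemotright>" "\<guillemotleft>2\<guillemotright> \<noteq> \<zero>"
      using nz double[OF that(3)] that(3) by auto
  qed
  have N: "N (a \<oplus> b) = \<zero>" "N (b \<oplus> c) = \<zero>" "N (c \<oplus> d) = \<zero>"
    using path N_idem by (auto simp: induced_path_def)
  have ac: "N (a \<oplus> c) = \<zero>" and bd: "N (b \<oplus> d) = \<zero>"
    using N_linked N carr by blast+
  have ad: "N (a \<oplus> d) = \<zero>"
    using N_linked[OF ac N(3)] carr by blast
  have two: "\<guillemotleft>2\<guillemotright> \<otimes> (a \<oplus> c) = \<ominus> \<guillemotleft>2\<guillemotright>" "\<guillemotleft>2\<guillemotright> \<otimes> (a \<oplus> d) = \<ominus> \<guillemotleft>2\<guillemotright>" "\<guillemotleft>2\<guillemotright> \<otimes> (b \<oplus> d) = \<ominus> \<guillemotleft>2\<guillemotright>"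
    and 2: "\<guillemotleft>2\<guillemotright> \<noteq> \<zero>"
    using nonidem ac ad bd path carr by (auto simp: induced_path_def)
  \<comment> \<open>The alternating sum of the three non-edges is the middle edge.\<close>
  have "\<guillemotleft>2\<guillemotright> \<otimes> (b \<oplus> c) = \<guillemotleft>2\<guillemotright> \<otimes> (a \<oplus> c) \<ominus> \<guillemotleft>2\<guillemotright> \<otimes> (a \<oplus> d) \<oplus> \<guillemotleft>2\<guillemotright> \<otimes> (b \<oplus> d)"
    using carr of_int_closed[of 2] by algebra
  then have bc: "\<guillemotleft>2\<guillemotright> \<otimes> (b \<oplus> c) = \<ominus> \<guillemotleft>2\<guillemotright>"
    unfolding two by (simp add: l_neg r_neg minus_eq)
  define w where "w = b \<oplus> c"
  have w: "w \<in> carrier R" "w \<otimes> w \<ominus> w = \<zero>" "\<guillemotleft>2\<guillemotright> \<otimes> w \<oplus> \<guillemotleft>2\<guillemotright> = \<zero>"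
    using path carr bc by (auto simp: w_def induced_path_def idempotents_iff minus_eq l_neg r_neg)
  \<comment> \<open>With \<open>2 w = -2\<close>, the element \<open>2 w^2\<close> is 2 when one
    factor \<open>w\<close> is absorbed, but -2 when \<open>w^2 = w\<close> is used. Hence
    \<open>4 = 0\<close>, and \<open>6 = 0\<close> gives \<open>2 = 0\<close>; the identity packs
    this into one equation.\<close>
  have "\<guillemotleft>2\<guillemotright> = (\<guillemotleft>2\<guillemotright> \<oplus> \<guillemotleft>2\<guillemotright> \<oplus> \<guillemotleft>2\<guillemotright>) \<ominus> \<guillemotleft>2\<guillemotright> \<otimes> (w \<otimes> w \<ominus> w)
      \<oplus> (w \<ominus> (\<one> \<oplus> \<one>)) \<otimes> (\<guillemotleft>2\<guillemotright> \<otimes> w \<oplus> \<guillemotleft>2\<guillemotright>)"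
    using w(1) of_int_closed[of 2] by algebra
  moreover have "\<guillemotleft>2\<guillemotright> \<oplus> \<guillemotleft>2\<guillemotright> \<oplus> \<guillemotleft>2\<guillemotright> = \<zero>"
    using 6 of_int_add[of 2 2] of_int_add[of 4 2] by simp
  ultimately show False
    using w 2 by simp
qed

end

section \<open>Local rings and their characteristic\<close>

text \<open>A finite ring has finitely many ideals, so among the proper ones above \<open>I\<close>
  there is a largest one in the sense of inclusion-maximality.\<close>

lemma (in cring) exists_maximalideal:
  assumes "finite (carrier R)" and "ideal I R" and "\<one> \<notin> I"
  shows "\<exists>M. maximalideal M R \<and> I \<subseteq> M"
proof -
  define A where "A = {J. ideal J R \<and> \<one> \<notin> J}"
  have sub: "J \<subseteq> carrier R" if "ideal J R" for J
    using that by (meson additive_subgroup.a_subset ideal.axioms(1))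
  have "A \<subseteq> Pow (carrier R)"
    using sub by (auto simp: A_def)
  then have "finite A"
    using assms(1) by (meson finite_Pow_iff finite_subset)
  moreover have "I \<in> A"
    using assms by (simp add: A_def)
  ultimately obtain M where M: "M \<in> A" "I \<subseteq> M" "\<And>J. J \<in> A \<Longrightarrow> M \<subseteq> J \<Longrightarrow> M = J"
    by (meson finite_has_maximal2)
  have "maximalideal M R"
  proof (rule maximalidealI)
    show "ideal M R" "carrier R \<noteq> M"
      using M(1) by (auto simp: A_def)
    fix J assume J: "ideal J R" "M \<subseteq> J" "J \<subseteq> carrier R"
    show "J = M \<or> J = carrier R"
    proof (cases "\<one> \<in> J")
      case True
      then show ?thesis
        using ideal.one_imp_carrier J(1) by blast
    next
      case False
      then show ?thesis
        using M(3) J by (auto simp: A_def)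
    qed
  qed
  then show ?thesis
    using M(2) by blast
qed

context local_ring
begin

lemma one_neq_zero: "\<one> \<noteq> \<zero>"
proof
  assume "\<one> = \<zero>"
  obtain M where "maximalideal M R"
    using unique_maximalideal by blast
  then interpret maximalideal M R .
  have "\<one> \<in> M"
    using \<open>\<one> = \<zero>\<close> additive_subgroup.zero_closed is_additive_subgroup by metis
  then show False
    using I_notcarr one_imp_carrier by simp
qed

text \<open>If \<open>e\<close> is neither 0 nor 1, then \<open>e\<close> and \<open>1 - e\<close>
  are idempotents different from 1, hence not units, and each lies in a maximal ideal. By locality
  it is the same ideal, which then contains their sum 1.\<close>

lemma idempotent_eq_zero_or_one:
  assumes fin: "finite (carrier R)" and e: "e \<in> idempotents R"
  shows "e = \<zero> \<or> e = \<one>"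
proof (rule ccontr)
  assume ne: "\<not> (e = \<zero> \<or> e = \<one>)"
  have max: "\<exists>M. maximalideal M R \<and> x \<in> M" if "x \<in> idempotents R" "x \<noteq> \<one>" for x
  proof -
    have x: "x \<in> carrier R" "x \<otimes> x = x"
      using that by (auto simp: idempotents_iff)
    \<comment> \<open>An invertible idempotent is 1: from \<open>1 = y x\<close> follows
      \<open>x = y x x = y x = 1\<close>.\<close>
    have "\<one> \<notin> PIdl x"
    proof
      assume "\<one> \<in> PIdl x"
      then obtain y where y: "y \<in> carrier R" "\<one> = y \<otimes> x"
        by (auto simp: cgenideal_def)
      then have "x = y \<otimes> x \<otimes> x"
        using x by (metis l_one)
      then have "x = y \<otimes> x"
        using x y(1) m_assoc by metis
      then show False
        using that y by simp
    qed
    then obtain M where "maximalideal M R" "PIdl x \<subseteq> M"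
      using exists_maximalideal[OF fin cgenideal_ideal] x by blast
    then show ?thesis
      using cgenideal_self x by blast
  qed
  have ec: "e \<in> carrier R" "e \<otimes> e = e"
    using e by (auto simp: idempotents_iff)
  have "(\<one> \<ominus> e) \<otimes> (\<one> \<ominus> e) = (\<one> \<ominus> e) \<oplus> (e \<otimes> e \<ominus> e)"
    using ec(1) by algebra
  moreover have sum: "e \<oplus> (\<one> \<ominus> e) = \<one>"
    using ec(1) by algebra
  ultimately have "\<one> \<ominus> e \<in> idempotents R"
    using ec by (simp add: idempotents_iff minus_eq r_neg)
  moreover have "\<one> \<ominus> e \<noteq> \<one>"
  proof
    assume "\<one> \<ominus> e = \<one>"
    moreover have "e = \<one> \<ominus> (\<one> \<ominus> e)"
      using ec(1) by algebra
    ultimately have "e = \<zero>"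
      by (simp add: minus_eq r_neg)
    then show False
      using ne by simp
  qed
  ultimately obtain M where M: "maximalideal M R" "e \<in> M" "\<one> \<ominus> e \<in> M"
    using max e ne unique_maximalideal by metis
  interpret maximalideal M R by fact
  have "e \<oplus> (\<one> \<ominus> e) \<in> M"
    using M by (simp add: additive_subgroup.a_closed is_additive_subgroup)
  then show False
    using sum I_notcarr one_imp_carrier by simp
qed

text \<open>Since \<open>9 = 6 + 3\<close>, the element 3 is idempotent, hence 0 or 1; in the latter
  case \<open>2 = 0\<close>.\<close>

lemma of_int_2_or_3_eq_zero:
  assumes fin: "finite (carrier R)" and 6: "\<guillemotleft>6\<guillemotright> = \<zero>"
  shows "\<guillemotleft>2\<guillemotright> = \<zero> \<or> \<guillemotleft>3\<guillemotright> = \<zero>"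
proof -
  have "\<guillemotleft>3\<guillemotright> \<otimes> \<guillemotleft>3\<guillemotright> = \<guillemotleft>6\<guillemotright> \<oplus> \<guillemotleft>3\<guillemotright>"
    using of_int_mult[of 3 3] of_int_add[of 6 3] by simp
  then have "\<guillemotleft>3\<guillemotright> \<in> idempotents R"
    using 6 by (simp add: idempotents_iff)
  then have "\<guillemotleft>3\<guillemotright> = \<zero> \<or> \<guillemotleft>3\<guillemotright> = \<one>"
    by (rule idempotent_eq_zero_or_one[OF fin])
  moreover have "\<guillemotleft>2\<guillemotright> = \<guillemotleft>3\<guillemotright> \<ominus> \<one>"
    using of_int_diff[of 3 1] by simp
  ultimately show ?thesis
    by (auto simp: minus_eq r_neg)
qed

text \<open>The least multiple exists because the order of the finite additive group annihilates the
  unit; the value 1 is excluded by \<open>one_neq_zero\<close>.\<close>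

lemma ring_char_eq_2_iff:
  assumes "finite (carrier R)"
  shows "ring_char R = 2 \<longleftrightarrow> \<guillemotleft>2\<guillemotright> = \<zero>"
proof -
  let ?P = "\<lambda>m::nat. 0 < m \<and> add_pow R m \<one> = \<zero>"
  have two: "add_pow R (2::nat) \<one> = \<guillemotleft>2\<guillemotright>"
    by (simp add: numeral_2_eq_2 of_int_2)
  have "add_pow R (order (add_monoid R)) \<one> = \<zero>"
    unfolding add_pow_def using group.pow_order_eq_1[OF a_group, of \<one>] by simp
  moreover have "0 < order (add_monoid R)"
    using assms one_closed by (auto simp: order_def card_gt_0_iff)
  ultimately have "?P (order (add_monoid R))"
    by blast
  then have "?P (ring_char R)"
    unfolding ring_char_def by (rule LeastI)
  moreover have "ring_char R = 2" if "?P 2"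
    unfolding ring_char_def
  proof (rule Least_equality)
    show "2 \<le> m" if "?P m" for m
    proof (rule ccontr)
      assume "\<not> 2 \<le> m"
      with that have "m = 1" by simp
      with that show False
        using one_neq_zero by simp
    qed
  qed (use that in auto)
  ultimately show ?thesis
    using two by auto
qed

end

section \<open>The ring of integers modulo 3\<close>

lemma ring_hom_of_int:
  assumes "ring R" and "ring S" and "h \<in> ring_hom R S"
  shows "h \<guillemotleft>i\<guillemotright>\<^bsub>R\<^esub> = \<guillemotleft>i\<guillemotright>\<^bsub>S\<^esub>"
proof -
  interpret R: ring R by fact
  interpret S: ring S by fact
  interpret ring_hom_ring R S h
    by (rule ring_hom_ringI2) fact+
  have "h (of_natural R n) = of_natural S n" for n
    by (induction n) simp_all
  then show ?thesis
    by (simp add: of_integer_def)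
qed

lemma of_int_int_ring: "\<guillemotleft>i\<guillemotright>\<^bsub>\<Z>\<^esub> = i"
proof -
  have "of_natural \<Z> n = int n" for n
    by (induction n) (simp_all add: of_natural_def)
  then show ?thesis
    by (simp add: of_integer_def int_a_inv_eq)
qed

lemma (in cring) of_int_ring_hom: "of_integer R \<in> ring_hom \<Z> R"
  by (rule ring_hom_memI) simp_all

lemma (in cring) of_int_mod_3:
  assumes "\<guillemotleft>3\<guillemotright> = \<zero>"
  shows "\<guillemotleft>i\<guillemotright> = \<guillemotleft>i mod 3\<guillemotright>"
proof -
  have "\<guillemotleft>i\<guillemotright> = \<guillemotleft>3 * (i div 3) + i mod 3\<guillemotright>"
    by simp
  also have "\<dots> = \<guillemotleft>i mod 3\<guillemotright>"
    unfolding of_int_add of_int_mult using assms by simp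
  finally show ?thesis .
qed

text \<open>The quotient map preserves integer multiples of the unit, so residue classes can be
  treated as such multiples.\<close>

lemma a_r_coset_eq_of_int_ZFact: "a_r_coset \<Z> (Idl\<^bsub>\<Z>\<^esub> {k}) i = \<guillemotleft>i\<guillemotright>\<^bsub>ZFact k\<^esub>"
proof -
  interpret I: ideal "Idl\<^bsub>\<Z>\<^esub> {k}" \<Z>
    by (rule int.genideal_ideal) simp
  show ?thesis
    using ring_hom_of_int[OF int.ring_axioms I.quotient_is_ring I.rcos_ring_hom, of i]
    by (simp add: ZFact_def of_int_int_ring)
qed

lemma of_int_ZFact_self: "\<guillemotleft>k\<guillemotright>\<^bsub>ZFact k\<^esub> = \<zero>\<^bsub>ZFact k\<^esub>"
proof -
  interpret I: ideal "Idl\<^bsub>\<Z>\<^esub> {k}" \<Z>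
    by (rule int.genideal_ideal) simp
  have "k \<in> Idl\<^bsub>\<Z>\<^esub> {k}"
    by (rule int.genideal_self') simp
  then have "\<guillemotleft>k\<guillemotright>\<^bsub>ZFact k\<^esub> = Idl\<^bsub>\<Z>\<^esub> {k}"
    using I.a_rcos_const a_r_coset_eq_of_int_ZFact by metis
  also have "\<dots> = \<zero>\<^bsub>ZFact k\<^esub>"
    by (simp add: ZFact_defs)
  finally show ?thesis .
qed

text \<open>The balanced representatives match the doubles 0, 2, -2 allowed in
  \<open>no_induced_path\<close>.\<close>

lemma carrier_ZFact_3:
  assumes "x \<in> carrier (ZFact 3)"
  shows "\<exists>m\<in>{0, 1, -1}. x = \<guillemotleft>m\<guillemotright>\<^bsub>ZFact 3\<^esub>"
proof -
  interpret Z3: cring "ZFact 3"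
    by (rule ZFact_is_cring)
  obtain i where "x = a_r_coset \<Z> (Idl\<^bsub>\<Z>\<^esub> {3}) i"
    using assms by (auto simp: ZFact_defs A_RCOSETS_def')
  then have "x = \<guillemotleft>i\<guillemotright>\<^bsub>ZFact 3\<^esub>"
    by (simp only: a_r_coset_eq_of_int_ZFact)
  moreover have "\<exists>m\<in>{0, 1, -1}. i mod 3 = m mod 3"
  proof -
    have "i mod 3 = 0 \<or> i mod 3 = 1 \<or> i mod 3 = 2"
      by presburger
    then show ?thesis
      by simp
  qed
  ultimately show ?thesis
    using Z3.of_int_mod_3[OF of_int_ZFact_self] by metis
qed

text \<open>First isomorphism theorem for the map from the integers: its kernel is generated by 3,
  as neither 1 nor 2 vanishes, and the images of 0, 1, -1 already fill the ring.\<close>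

lemma (in cring) ZFact_3_iso:
  assumes 3: "\<guillemotleft>3\<guillemotright> = \<zero>" and "\<one> \<noteq> \<zero>" and "carrier R \<subseteq> {\<zero>, \<one>, \<ominus> \<one>}"
  shows "ZFact 3 \<simeq> R"
proof -
  interpret h: ring_hom_ring \<Z> R "of_integer R"
    by (intro ring_hom_ringI2 int.ring_axioms ring_axioms of_int_ring_hom)
  have "\<guillemotleft>2\<guillemotright> \<noteq> \<zero>"
  proof
    assume "\<guillemotleft>2\<guillemotright> = \<zero>"
    moreover have "\<one> = \<guillemotleft>3\<guillemotright> \<ominus> \<guillemotleft>2\<guillemotright>"
      using of_int_diff[of 3 2] by simp
    ultimately show False
      using 3 assms(2) by simp
  qed
  moreover have "i mod 3 = 0 \<or> i mod 3 = 1 \<or> i mod 3 = 2" for i :: int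
    by presburger
  ultimately have "\<guillemotleft>i\<guillemotright> = \<zero> \<longleftrightarrow> 3 dvd i" for i
    using of_int_mod_3[OF 3, of i] assms(2) unfolding dvd_eq_mod_eq_0
    by (metis of_int_0 of_int_1)
  then have "a_kernel \<Z> R (of_integer R) = {i. 3 dvd i}"
    unfolding a_kernel_def' by blast
  also have "\<dots> = Idl\<^bsub>\<Z>\<^esub> {3}"
    unfolding int_Idl by (auto elim: dvdE)
  finally have "a_kernel \<Z> R (of_integer R) = Idl\<^bsub>\<Z>\<^esub> {3}" .
  moreover have "of_integer R ` carrier \<Z> = carrier R"
  proof
    have "{\<guillemotleft>0\<guillemotright>, \<guillemotleft>1\<guillemotright>, \<guillemotleft>-1\<guillemotright>} \<subseteq> of_integer R ` carrier \<Z>"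
      unfolding int_carrier_eq by blast
    then have "{\<zero>, \<one>, \<ominus> \<one>} \<subseteq> of_integer R ` carrier \<Z>"
      by simp
    with assms(3) show "carrier R \<subseteq> of_integer R ` carrier \<Z>"
      by (rule subset_trans)
  qed auto
  ultimately show ?thesis
    using h.FactRing_iso by (simp add: ZFact_def)
qed

section \<open>Direct products\<close>

lemma RDirProd_simps:
  "(a, b) \<otimes>\<^bsub>RDirProd R S\<^esub> (c, d) = (a \<otimes>\<^bsub>R\<^esub> c, b \<otimes>\<^bsub>S\<^esub> d)"
  "(a, b) \<oplus>\<^bsub>RDirProd R S\<^esub> (c, d) = (a \<oplus>\<^bsub>R\<^esub> c, b \<oplus>\<^bsub>S\<^esub> d)"
  "\<one>\<^bsub>RDirProd R S\<^esub> = (\<one>\<^bsub>R\<^esub>, \<one>\<^bsub>S\<^esub>)"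
  by (simp_all add: RDirProd_def DirProd_def monoid.defs)

lemma fst_ring_hom: "fst \<in> ring_hom (RDirProd R S) R"
  and snd_ring_hom: "snd \<in> ring_hom (RDirProd R S) S"
  by (auto simp: ring_hom_def RDirProd_carrier RDirProd_simps)

lemma nth_ring_hom:
  "i < length Rs \<Longrightarrow> (\<lambda>xs. xs ! i) \<in> ring_hom (RDirProd_list Rs) (Rs ! i)"
proof (induction Rs arbitrary: i)
  case (Cons R Rs)
  let ?P = "RDirProd_list (R # Rs)"
  \<comment> \<open>The operations of the list product are transported from the binary product along
    the map that prepends the first component.\<close>
  note hom = ring_hom_memE[OF RDirProd_list_hom1[of R Rs], unfolded RDirProd_carrier]
  have mult: "(a # as) \<otimes>\<^bsub>?P\<^esub> (b # bs) = (a \<otimes>\<^bsub>R\<^esub> b) # (as \<otimes>\<^bsub>RDirProd_list Rs\<^esub> bs)"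
    and add: "(a # as) \<oplus>\<^bsub>?P\<^esub> (b # bs) = (a \<oplus>\<^bsub>R\<^esub> b) # (as \<oplus>\<^bsub>RDirProd_list Rs\<^esub> bs)"
    if "a \<in> carrier R" "as \<in> carrier (RDirProd_list Rs)"
      "b \<in> carrier R" "bs \<in> carrier (RDirProd_list Rs)" for a as b bs
    using hom(2)[of "(a, as)" "(b, bs)"] hom(3)[of "(a, as)" "(b, bs)"] that
    by (simp_all add: RDirProd_simps)
  have one: "\<one>\<^bsub>?P\<^esub> = \<one>\<^bsub>R\<^esub> # \<one>\<^bsub>RDirProd_list Rs\<^esub>"
    using hom(4) by (simp add: RDirProd_simps)
  show ?case
  proof (cases i)
    case 0
    then show ?thesis
      by (auto simp: ring_hom_def RDirProd_list_carrier mult add one)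
  next
    case (Suc j)
    then have "(\<lambda>xs. xs ! j) \<in> ring_hom (RDirProd_list Rs) (Rs ! j)"
      using Cons by simp
    with Suc show ?thesis
      by (auto simp: ring_hom_def RDirProd_list_carrier mult add one Pi_iff)
  qed
qed simp

lemma is_ring_isoI: "f \<in> ring_iso R S \<Longrightarrow> R \<simeq> S"
  by (auto simp: is_ring_iso_def)

lemma RDirProd_cong:
  assumes "R \<simeq> R'" and "S \<simeq> S'"
  shows "RDirProd R S \<simeq> RDirProd R' S'"
  using assms RDirProd_iso6 unfolding is_ring_iso_def by fastforce

lemma RDirProd_list_Cons_iso:
  "RDirProd_list (R # Rs) \<simeq> RDirProd R (RDirProd_list Rs)"
  "RDirProd R (RDirProd_list Rs) \<simeq> RDirProd_list (R # Rs)"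
  by (rule is_ring_isoI, rule RDirProd_list_iso2) (rule is_ring_isoI, rule RDirProd_list_iso1)

lemma RDirProd_left_commute: "RDirProd R (RDirProd S T) \<simeq> RDirProd S (RDirProd R T)"
proof -
  have "RDirProd R (RDirProd S T) \<simeq> RDirProd (RDirProd R S) T"
    by (rule is_ring_isoI, rule RDirProd_iso2)
  moreover have "RDirProd (RDirProd R S) T \<simeq> RDirProd (RDirProd S R) T"
    by (intro RDirProd_cong ring_iso_refl is_ring_isoI[OF RDirProd_iso1])
  moreover have "RDirProd (RDirProd S R) T \<simeq> RDirProd S (RDirProd R T)"
    by (rule is_ring_isoI, rule RDirProd_iso3)
  ultimately show ?thesis
    by (meson ring_iso_trans)
qed

text \<open>Each factor in front of \<open>R\<close> is exchanged with it by
  \<open>RDirProd_left_commute\<close>. This isolates a factor at an arbitrary position.\<close>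

lemma RDirProd_list_middle_iso:
  "RDirProd_list (Rs @ R # Ss) \<simeq> RDirProd R (RDirProd_list (Rs @ Ss))"
proof (induction Rs)
  case Nil
  show ?case
    by (simp add: RDirProd_list_Cons_iso)
next
  case (Cons S Rs)
  have "RDirProd_list ((S # Rs) @ R # Ss) \<simeq> RDirProd S (RDirProd_list (Rs @ R # Ss))"
    by (simp add: RDirProd_list_Cons_iso)
  also have "\<dots> \<simeq> RDirProd S (RDirProd R (RDirProd_list (Rs @ Ss)))"
    by (intro RDirProd_cong ring_iso_refl Cons.IH)
  also (ring_iso_trans) have "\<dots> \<simeq> RDirProd R (RDirProd S (RDirProd_list (Rs @ Ss)))"
    by (rule RDirProd_left_commute)
  also (ring_iso_trans) have "\<dots> \<simeq> RDirProd R (RDirProd_list ((S # Rs) @ Ss))"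
    by (intro RDirProd_cong ring_iso_refl) (simp add: RDirProd_list_Cons_iso)
  finally (ring_iso_trans) show ?case .
qed

section \<open>Cograph idempotent graphs\<close>

lemma (in cring) cograph_idempotent_graph_iff:
  assumes "finite (carrier R)"
  shows "cograph (with_proj (idempotent_graph R)) \<longleftrightarrow> (\<forall>a b c d. \<not> induced_path a b c d)"
  using cograph_with_proj_iff[OF pair_graph_idempotent_graph[OF is_cring assms]]
  by (auto simp: idempotent_graph_def induced_path_def)

lemma (in ring) one_eq_neg_one_iff: "\<one> = \<ominus> \<one> \<longleftrightarrow> \<guillemotleft>2\<guillemotright> = \<zero>"
  by (simp add: eq_neg_iff_add_eq_0 of_int_2)

text \<open>When \<open>3 = 0\<close>, the map sending \<open>a\<close> to \<open>1 + 2 a\<close> is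
  \<open>1 - a\<close>, an involution. Thus \<open>b = 1 + 2 a\<close> can take any prescribed
  value.\<close>

lemma (in cring) one_plus_double_one_minus:
  assumes "d \<in> carrier R" and "\<guillemotleft>3\<guillemotright> = \<zero>"
  shows "\<one> \<oplus> \<guillemotleft>2\<guillemotright> \<otimes> (\<one> \<ominus> d) = d"
proof -
  have "\<one> \<oplus> \<guillemotleft>2\<guillemotright> \<otimes> (\<one> \<ominus> d) = \<guillemotleft>3\<guillemotright> \<otimes> (\<one> \<ominus> d) \<oplus> d"
    using assms(1) by (simp only: of_int_numerals, algebra)
  then show ?thesis
    using assms by simp
qed

lemma (in cring) of_int_6_eq_zero:
  assumes "\<guillemotleft>2\<guillemotright> = \<zero> \<or> \<guillemotleft>3\<guillemotright> = \<zero>"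
  shows "\<guillemotleft>6\<guillemotright> = \<zero>"
  using of_int_mult[of 2 3] assms by auto

text \<open>After the removal of position \<open>k\<close>, later entries are shifted by one; so the
  remaining factors are original factors at positions other than \<open>k\<close>.\<close>

lemma nth_take_append_drop:
  assumes "k < length xs" and "i < length (take k xs @ drop (Suc k) xs)"
  shows "\<exists>j<length xs. j \<noteq> k \<and> (take k xs @ drop (Suc k) xs) ! i = xs ! j"
  using assms by (intro exI[of _ "if i < k then i else Suc i"]) (auto simp: nth_append min_def)

lemma RDirProd_list_eqI:
  assumes "xs \<in> carrier (RDirProd_list Rs)" and "ys \<in> carrier (RDirProd_list Rs)"
    and "\<And>i. i < length Rs \<Longrightarrow> xs ! i = ys ! i"
  shows "xs = ys"
  using assms by (metis RDirProd_list_carrier_mem(1) nth_equalityI)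

text \<open>If \<open>x^2 = -x\<close>, then \<open>-x\<close> is idempotent, and a finite local
  ring has only the idempotents 0 and 1.\<close>

lemma (in local_ring) carrier_subset_if_square_eq:
  assumes "finite (carrier R)"
    and sq: "\<And>x. x \<in> carrier R \<Longrightarrow> x \<otimes> x = x \<or> x \<otimes> x = \<ominus> x"
  shows "carrier R \<subseteq> {\<zero>, \<one>, \<ominus> \<one>}"
proof
  fix x assume x: "x \<in> carrier R"
  then have "x \<in> idempotents R \<or> \<ominus> x \<in> idempotents R"
    using sq[OF x] by (auto simp: idempotents_iff l_minus r_minus)
  then have "x = \<zero> \<or> x = \<one> \<or> \<ominus> x = \<zero> \<or> \<ominus> x = \<one>"
    using idempotent_eq_zero_or_one[OF assms(1)] by blast
  then show "x \<in> {\<zero>, \<one>, \<ominus> \<one>}"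
    using x minus_minus[OF x] minus_zero by (metis insertCI)
qed

text \<open>The position \<open>k\<close> of the exceptional factor is existentially quantified
  because the numbering of the factors is arbitrary.\<close>

theorem theorem4p3:
  fixes R :: "('a, 'm) ring_scheme"
    and Rs :: "('b, 'k) ring_scheme list"
    and n :: nat
  assumes "cring R" and "finite (carrier R)"
    and "2 \<le> n" and "length Rs = n"
    and "\<forall>i<n. local_ring (Rs ! i)"
    and "R \<simeq> RDirProd_list Rs"
  shows "cograph (with_proj (idempotent_graph R)) \<longleftrightarrow>
           (\<forall>i<n. ring_char (Rs ! i) = 2)
         \<or> (\<exists>k<n. R \<simeq> RDirProd (ZFact 3) (RDirProd_list (take k Rs @ drop (Suc k) Rs))
                \<and> (\<forall>i<n. i \<noteq> k \<longrightarrow> ring_char (Rs ! i) = 2))"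
proof -
  interpret R: cring R by fact
  note len = \<open>length Rs = n\<close>
  have local: "local_ring (Rs ! i)" if "i < n" for i
    using assms(5) that by blast
  have cring: "cring (Rs ! i)" if "i < n" for i
    using local[OF that] by (rule local_ring.axioms)
  have ring: "ring (Rs ! i)" if "i < n" for i
    using cring[OF that] by (rule cring.axioms)

  \<comment> \<open>Component maps onto the local factors\<close>
  obtain g where g: "g \<in> ring_hom R (RDirProd_list Rs)"
    and bij: "bij_betw g (carrier R) (carrier (RDirProd_list Rs))"
    using assms(6) by (auto simp: is_ring_iso_def ring_iso_def)
  define f where "f i x = g x ! i" for i x
  have f_hom: "f i \<in> ring_hom R (Rs ! i)" if "i < n" for i
    using ring_hom_trans[OF g nth_ring_hom] that len by (simp add: comp_def f_def[abs_def])
  have f_int: "f i \<guillemotleft>m\<guillemotright>\<^bsub>R\<^esub> = \<guillemotleft>m\<guillemotright>\<^bsub>Rs ! i\<^esub>" if "i < n" for i m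
    using ring_hom_of_int[OF R.ring_axioms ring f_hom] that by blast
  have f_surj: "\<exists>x\<in>carrier R. \<forall>i<n. f i x = c i"
    if "\<And>i. i < n \<Longrightarrow> c i \<in> carrier (Rs ! i)" for c
  proof -
    have "map c [0..<n] \<in> carrier (RDirProd_list Rs)"
      using that len by (intro RDirProd_list_carrier_memI) auto
    then obtain x where "x \<in> carrier R" "g x = map c [0..<n]"
      using bij by (metis bij_betw_imp_surj_on imageE)
    then show ?thesis
      by (intro bexI[of _ x]) (auto simp: f_def)
  qed
  have fin: "finite (carrier (Rs ! i))" if i: "i < n" for i
  proof -
    \<comment> \<open>Each factor is an image of \<open>R\<close>: put \<open>y\<close> at position
      \<open>i\<close> and zeros elsewhere.\<close>
    have "y \<in> f i ` carrier R" if "y \<in> carrier (Rs ! i)" for y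
      using f_surj[of "\<lambda>j. if j = i then y else \<zero>\<^bsub>Rs ! j\<^esub>"] that i ring
      by (force simp: ring.ring_simprules)
    then show ?thesis
      using assms(2) by (meson finite_imageI finite_subset subsetI)
  qed
  have char: "ring_char (Rs ! i) = 2 \<longleftrightarrow> \<guillemotleft>2\<guillemotright>\<^bsub>Rs ! i\<^esub> = \<zero>\<^bsub>Rs ! i\<^esub>" if "i < n" for i
    using local_ring.ring_char_eq_2_iff[OF local fin] that by blast
  show ?thesis
  proof (intro iffI)

    \<comment> \<open>From a cograph to the shape of the factors\<close>
    assume "cograph (with_proj (idempotent_graph R))"
    then have no_path: "\<not> R.induced_path a b c d" for a b c d
      using R.cograph_idempotent_graph_iff assms(2) by blast
    have "\<guillemotleft>6\<guillemotright>\<^bsub>R\<^esub> = \<zero>\<^bsub>R\<^esub>"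
      using no_path R.induced_path_0_1_neg1_2 by blast
    then have "\<guillemotleft>6\<guillemotright>\<^bsub>Rs ! i\<^esub> = \<zero>\<^bsub>Rs ! i\<^esub>" if "i < n" for i
      using f_int[OF that, of 6] f_int[OF that, of 0] that ring ring.of_int_0 R.of_int_0 by metis
    then have three: "\<guillemotleft>3\<guillemotright>\<^bsub>Rs ! i\<^esub> = \<zero>\<^bsub>Rs ! i\<^esub>"
      if "i < n" "\<guillemotleft>2\<guillemotright>\<^bsub>Rs ! i\<^esub> \<noteq> \<zero>\<^bsub>Rs ! i\<^esub>" for i
      using local_ring.of_int_2_or_3_eq_zero[OF local fin] that by blast
    \<comment> \<open>The same alternative holds in all factors with nonzero 2 at once, because it
      comes from a single \<open>b\<close> in \<open>R\<close> whose components there are the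
      prescribed \<open>d i\<close>.\<close>
    have square: "(\<forall>i<n. \<guillemotleft>2\<guillemotright>\<^bsub>Rs ! i\<^esub> \<noteq> \<zero>\<^bsub>Rs ! i\<^esub> \<longrightarrow> d i \<otimes>\<^bsub>Rs ! i\<^esub> d i = d i)
        \<or> (\<forall>i<n. \<guillemotleft>2\<guillemotright>\<^bsub>Rs ! i\<^esub> \<noteq> \<zero>\<^bsub>Rs ! i\<^esub> \<longrightarrow> d i \<otimes>\<^bsub>Rs ! i\<^esub> d i = \<ominus>\<^bsub>Rs ! i\<^esub> d i)"
      if d: "\<And>i. i < n \<Longrightarrow> d i \<in> carrier (Rs ! i)" for d
    proof (cases "\<guillemotleft>2\<guillemotright>\<^bsub>R\<^esub> = \<zero>\<^bsub>R\<^esub>")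
      case True
      then have "\<guillemotleft>2\<guillemotright>\<^bsub>Rs ! i\<^esub> = \<zero>\<^bsub>Rs ! i\<^esub>" if "i < n" for i
        using f_int[OF that, of 2] f_int[OF that, of 0] that ring ring.of_int_0 R.of_int_0 by metis
      then show ?thesis by blast
    next
      case False
      have "\<one>\<^bsub>Rs ! i\<^esub> \<ominus>\<^bsub>Rs ! i\<^esub> d i \<in> carrier (Rs ! i)" if "i < n" for i
        using ring[OF that] d[OF that] by (simp add: ring.ring_simprules)
      then obtain a where a: "a \<in> carrier R" "\<And>i. i < n \<Longrightarrow> f i a = \<one>\<^bsub>Rs ! i\<^esub> \<ominus>\<^bsub>Rs ! i\<^esub> d i"
        using f_surj[of "\<lambda>i. \<one>\<^bsub>Rs ! i\<^esub> \<ominus>\<^bsub>Rs ! i\<^esub> d i"] by blast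
      define b where "b = \<one>\<^bsub>R\<^esub> \<oplus>\<^bsub>R\<^esub> \<guillemotleft>2\<guillemotright>\<^bsub>R\<^esub> \<otimes>\<^bsub>R\<^esub> a"
      have b: "b \<in> carrier R"
        using a by (simp add: b_def)
      have fb: "f i b = d i" if i: "i < n" "\<guillemotleft>2\<guillemotright>\<^bsub>Rs ! i\<^esub> \<noteq> \<zero>\<^bsub>Rs ! i\<^esub>" for i
      proof -
        interpret h: ring_hom_ring R "Rs ! i" "f i"
          using i f_hom ring R.ring_axioms by (intro ring_hom_ringI2)
        have "f i b = \<one>\<^bsub>Rs ! i\<^esub> \<oplus>\<^bsub>Rs ! i\<^esub> \<guillemotleft>2\<guillemotright>\<^bsub>Rs ! i\<^esub> \<otimes>\<^bsub>Rs ! i\<^esub> (\<one>\<^bsub>Rs ! i\<^esub> \<ominus>\<^bsub>Rs ! i\<^esub> d i)"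
          using a i f_int by (simp add: b_def)
        also have "\<dots> = d i"
          using cring.one_plus_double_one_minus[OF cring d three] i by blast
        finally show ?thesis .
      qed
      have f_sq: "f i (b \<otimes>\<^bsub>R\<^esub> b) = f i b \<otimes>\<^bsub>Rs ! i\<^esub> f i b" 
        and f_neg: "f i (\<ominus>\<^bsub>R\<^esub> b) = \<ominus>\<^bsub>Rs ! i\<^esub> f i b" if i: "i < n" for i
      proof -
        interpret h: ring_hom_ring R "Rs ! i" "f i"
          using i f_hom ring R.ring_axioms by (intro ring_hom_ringI2)
        show "f i (b \<otimes>\<^bsub>R\<^esub> b) = f i b \<otimes>\<^bsub>Rs ! i\<^esub> f i b" "f i (\<ominus>\<^bsub>R\<^esub> b) = \<ominus>\<^bsub>Rs ! i\<^esub> f i b"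
          using b by simp_all
      qed
      have "b \<otimes>\<^bsub>R\<^esub> b = b \<or> b \<otimes>\<^bsub>R\<^esub> b = \<ominus>\<^bsub>R\<^esub> b"
        using no_path R.induced_path_a_neg_a[OF a(1) False b_def] by blast
      then show ?thesis
        using fb f_sq f_neg by metis
    qed
    show "(\<forall>i<n. ring_char (Rs ! i) = 2)
         \<or> (\<exists>k<n. R \<simeq> RDirProd (ZFact 3) (RDirProd_list (take k Rs @ drop (Suc k) Rs))
                \<and> (\<forall>i<n. i \<noteq> k \<longrightarrow> ring_char (Rs ! i) = 2))"
    proof (cases "\<forall>i<n. ring_char (Rs ! i) = 2")
      case False
      then obtain k where k: "k < n" and k2: "\<guillemotleft>2\<guillemotright>\<^bsub>Rs ! k\<^esub> \<noteq> \<zero>\<^bsub>Rs ! k\<^esub>"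
        using char by blast
      interpret K: local_ring "Rs ! k"
        by (rule local[OF k])
      \<comment> \<open>Only component \<open>k\<close> of the family matters; the zeros are
        fillers.\<close>
      have "x \<otimes>\<^bsub>Rs ! k\<^esub> x = x \<or> x \<otimes>\<^bsub>Rs ! k\<^esub> x = \<ominus>\<^bsub>Rs ! k\<^esub> x" if "x \<in> carrier (Rs ! k)" for x
        using square[of "\<lambda>i. if i = k then x else \<zero>\<^bsub>Rs ! i\<^esub>"] that k k2 ring
        by (fastforce simp: ring.ring_simprules)
      then have "ZFact 3 \<simeq> Rs ! k"
        using K.carrier_subset_if_square_eq[OF fin[OF k]] K.ZFact_3_iso[OF three[OF k k2] K.one_neq_zero]
        by blast
      then have iso: "Rs ! k \<simeq> ZFact 3"
        using ring_iso_sym cring.axioms(1)[OF ZFact_is_cring] by blast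
      have "R \<simeq> RDirProd_list (take k Rs @ Rs ! k # drop (Suc k) Rs)"
        using assms(6) id_take_nth_drop[of k Rs] k len by simp
      then have "R \<simeq> RDirProd (Rs ! k) (RDirProd_list (take k Rs @ drop (Suc k) Rs))"
        using RDirProd_list_middle_iso ring_iso_trans by blast
      then have "R \<simeq> RDirProd (ZFact 3) (RDirProd_list (take k Rs @ drop (Suc k) Rs))"
        using RDirProd_cong[OF iso ring_iso_refl] ring_iso_trans by blast
      moreover have "ring_char (Rs ! j) = 2" if j: "j < n" "j \<noteq> k" for j
      proof (rule ccontr)
        assume "ring_char (Rs ! j) \<noteq> 2"
        then have j2: "\<guillemotleft>2\<guillemotright>\<^bsub>Rs ! j\<^esub> \<noteq> \<zero>\<^bsub>Rs ! j\<^esub>"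
          using char j by blast
        interpret J: local_ring "Rs ! j"
          by (rule local[OF j(1)])
        \<comment> \<open>Both alternatives of \<open>square\<close> fail: -1 at \<open>j\<close> is
          not idempotent, and 1 at \<open>k\<close> has square different from its negative.\<close>
        define d where "d i = (if i = k then \<one>\<^bsub>Rs ! i\<^esub> else \<ominus>\<^bsub>Rs ! i\<^esub> \<one>\<^bsub>Rs ! i\<^esub>)" for i
        have "d i \<in> carrier (Rs ! i)" if "i < n" for i
          using ring[OF that] by (simp add: d_def ring.ring_simprules)
        from square[of d, OF this]
        have "d j \<otimes>\<^bsub>Rs ! j\<^esub> d j = d j \<or> d k \<otimes>\<^bsub>Rs ! k\<^esub> d k = \<ominus>\<^bsub>Rs ! k\<^esub> d k"
          using k k2 j j2 by blast
        then show False
          using j k2 j2 K.one_eq_neg_one_iff J.one_eq_neg_one_iff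
          by (simp add: d_def J.l_minus J.r_minus)
      qed
      ultimately show ?thesis
        using k by blast
    qed blast
  next

    \<comment> \<open>From the shape of the factors to a cograph\<close>
    assume rhs: "(\<forall>i<n. ring_char (Rs ! i) = 2)
         \<or> (\<exists>k<n. R \<simeq> RDirProd (ZFact 3) (RDirProd_list (take k Rs @ drop (Suc k) Rs))
                \<and> (\<forall>i<n. i \<noteq> k \<longrightarrow> ring_char (Rs ! i) = 2))"
    \<comment> \<open>These are the two assumptions of \<open>no_induced_path\<close>; both shapes
      of the factors are used only through them.\<close>
    have "\<guillemotleft>6\<guillemotright>\<^bsub>R\<^esub> = \<zero>\<^bsub>R\<^esub> \<and>
      (\<forall>x\<in>carrier R. \<guillemotleft>2\<guillemotright>\<^bsub>R\<^esub> \<otimes>\<^bsub>R\<^esub> x \<in> {\<zero>\<^bsub>R\<^esub>, \<guillemotleft>2\<guillemotright>\<^bsub>R\<^esub>, \<ominus>\<^bsub>R\<^esub> \<guillemotleft>2\<guillemotright>\<^bsub>R\<^esub>})"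
      using rhs
    proof
      assume "\<forall>i<n. ring_char (Rs ! i) = 2"
      then have "f i \<guillemotleft>2\<guillemotright>\<^bsub>R\<^esub> = f i \<guillemotleft>0\<guillemotright>\<^bsub>R\<^esub>" if "i < n" for i
        using that char f_int ring ring.of_int_0 by metis
      then have "g \<guillemotleft>2\<guillemotright>\<^bsub>R\<^esub> = g \<guillemotleft>0\<guillemotright>\<^bsub>R\<^esub>"
        using len ring_hom_memE(1)[OF g] by (intro RDirProd_list_eqI) (auto simp: f_def)
      then have "\<guillemotleft>2\<guillemotright>\<^bsub>R\<^esub> = \<zero>\<^bsub>R\<^esub>"
        using bij R.of_int_closed R.of_int_0 by (metis bij_betw_imp_inj_on inj_onD)
      then show ?thesis
        using R.of_int_6_eq_zero by simp
    next
      assume "\<exists>k<n. R \<simeq> RDirProd (ZFact 3) (RDirProd_list (take k Rs @ drop (Suc k) Rs))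
                \<and> (\<forall>i<n. i \<noteq> k \<longrightarrow> ring_char (Rs ! i) = 2)"
      then obtain k Ts where k: "k < n" and Ts: "Ts = take k Rs @ drop (Suc k) Rs"
        and iso: "R \<simeq> RDirProd (ZFact 3) (RDirProd_list Ts)"
        and char2: "\<And>i. i < n \<Longrightarrow> i \<noteq> k \<Longrightarrow> ring_char (Rs ! i) = 2"
        by blast
      interpret Z3: cring "ZFact 3"
        by (rule ZFact_is_cring)
      obtain h where h: "h \<in> ring_hom R (RDirProd (ZFact 3) (RDirProd_list Ts))"
        and h_inj: "inj_on h (carrier R)"
        using iso by (auto simp: is_ring_iso_def ring_iso_def bij_betw_def)
      have T: "cring (Ts ! i)" "\<guillemotleft>2\<guillemotright>\<^bsub>Ts ! i\<^esub> = \<zero>\<^bsub>Ts ! i\<^esub>" if "i < length Ts" for i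
        using nth_take_append_drop[of k Rs i] that k len cring char char2 by (auto simp: Ts)
      \<comment> \<open>\<open>p\<close> is the component modulo 3, and the \<open>q i\<close> are
        the components of characteristic 2; together they separate the elements of
        \<open>R\<close>.\<close>
      define p where "p = fst \<circ> h"
      define q where "q i = (\<lambda>xs. xs ! i) \<circ> (snd \<circ> h)" for i
      have p_hom: "p \<in> ring_hom R (ZFact 3)"
        unfolding p_def by (rule ring_hom_trans[OF h fst_ring_hom])
      have q_hom: "q i \<in> ring_hom R (Ts ! i)" if "i < length Ts" for i
        unfolding q_def by (rule ring_hom_trans[OF ring_hom_trans[OF h snd_ring_hom] nth_ring_hom[OF that]])
      have eqI: "x = y" if x: "x \<in> carrier R" and y: "y \<in> carrier R" and "p x = p y"
        and "\<And>i. i < length Ts \<Longrightarrow> q i x = q i y" for x y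
      proof -
        have "snd (h x) = snd (h y)"
          using that ring_hom_memE(1)[OF h x] ring_hom_memE(1)[OF h y]
          by (intro RDirProd_list_eqI) (auto simp: q_def RDirProd_carrier)
        then have "h x = h y"
          using that by (simp add: p_def prod_eq_iff)
        then show ?thesis
          using h_inj x y by (meson inj_onD)
      qed
      have p_int: "p \<guillemotleft>m\<guillemotright>\<^bsub>R\<^esub> = \<guillemotleft>m\<guillemotright>\<^bsub>ZFact 3\<^esub>" for m
        by (rule ring_hom_of_int[OF R.ring_axioms Z3.ring_axioms p_hom])
      have q_int: "q i \<guillemotleft>m\<guillemotright>\<^bsub>R\<^esub> = \<guillemotleft>m\<guillemotright>\<^bsub>Ts ! i\<^esub>" if "i < length Ts" for i m
        using ring_hom_of_int[OF R.ring_axioms _ q_hom] T(1) that cring.axioms(1) by blast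
      have q_double: "q i (\<guillemotleft>2\<guillemotright>\<^bsub>R\<^esub> \<otimes>\<^bsub>R\<^esub> x) = \<zero>\<^bsub>Ts ! i\<^esub>"
        if i: "i < length Ts" and x: "x \<in> carrier R" for i x
      proof -
        interpret Ti: cring "Ts ! i"
          by (rule T(1)[OF i])
        show ?thesis
          using ring_hom_memE(1,2)[OF q_hom[OF i]] x q_int[OF i] T(2)[OF i] by simp
      qed
      have "\<guillemotleft>6\<guillemotright>\<^bsub>R\<^esub> = \<guillemotleft>0\<guillemotright>\<^bsub>R\<^esub>"
      proof (rule eqI)
        show "p \<guillemotleft>6\<guillemotright>\<^bsub>R\<^esub> = p \<guillemotleft>0\<guillemotright>\<^bsub>R\<^esub>"
          unfolding p_int using Z3.of_int_6_eq_zero of_int_ZFact_self by simp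
        show "q i \<guillemotleft>6\<guillemotright>\<^bsub>R\<^esub> = q i \<guillemotleft>0\<guillemotright>\<^bsub>R\<^esub>" if "i < length Ts" for i
          using cring.of_int_6_eq_zero T q_int that ring.of_int_0 cring.axioms(1) by metis
      qed simp_all
      moreover have "\<guillemotleft>2\<guillemotright>\<^bsub>R\<^esub> \<otimes>\<^bsub>R\<^esub> x \<in> {\<zero>\<^bsub>R\<^esub>, \<guillemotleft>2\<guillemotright>\<^bsub>R\<^esub>, \<ominus>\<^bsub>R\<^esub> \<guillemotleft>2\<guillemotright>\<^bsub>R\<^esub>}" if x: "x \<in> carrier R" for x
      proof -
        obtain m where m: "m \<in> {0, 1, -1}" "p x = \<guillemotleft>m\<guillemotright>\<^bsub>ZFact 3\<^esub>"
          using carrier_ZFact_3[OF ring_hom_memE(1)[OF p_hom x]] by (rule bexE)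
        \<comment> \<open>Doubles vanish in all components of characteristic 2, so they depend only
          on the component modulo 3, where \<open>x\<close> agrees with the integer
          \<open>m\<close>.\<close>
        have "\<guillemotleft>2\<guillemotright>\<^bsub>R\<^esub> \<otimes>\<^bsub>R\<^esub> x = \<guillemotleft>2\<guillemotright>\<^bsub>R\<^esub> \<otimes>\<^bsub>R\<^esub> \<guillemotleft>m\<guillemotright>\<^bsub>R\<^esub>"
        proof (rule eqI)
          show "p (\<guillemotleft>2\<guillemotright>\<^bsub>R\<^esub> \<otimes>\<^bsub>R\<^esub> x) = p (\<guillemotleft>2\<guillemotright>\<^bsub>R\<^esub> \<otimes>\<^bsub>R\<^esub> \<guillemotleft>m\<guillemotright>\<^bsub>R\<^esub>)"
            using ring_hom_memE(2)[OF p_hom] x m(2) p_int by simp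
        qed (use x q_double in simp_all)
        then show ?thesis
          using m(1) by (auto simp: R.r_minus)
      qed
      ultimately show ?thesis
        by simp
    qed
    then show "cograph (with_proj (idempotent_graph R))"
      using R.cograph_idempotent_graph_iff[OF assms(2)] R.no_induced_path by blast
  qed
qed

end
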